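(* Let $\delta := 2\epsilon + \frac{2-\omega}{\omega}\min(\mathrm{diag}(\mathbf{D}))$ and let $\omega\in(0,2)$, $\epsilon\in[0,\infty)$ be chosen such that $\delta\in(0,\infty)$. Let $\mathbf{x}^*$ be a global minimizer of $f$ and assume there is a constant $\eta\in(0,\infty)$ such that $\|\mathbf{x}-\mathbf{x}^*\|\le\eta\|\mathbf{x}-\mathcal{T}(\mathbf{x})\|$ for every $\mathbf{x}\in\mathbb{R}^n$ that is not a minimizer of $f$. Let $\mathbf{x}^{k+1}=\mathcal{T}(\mathbf{x}^k)$, $k\ge0$, and assume $\{\mathbf{x}^k\}$ is bounded. With $C_1:=2\|\mathbf{B}\|\eta/\delta-1$, for all $k\ge0$: $$f(\mathbf{x}^k)-f(\mathbf{x}^* )\le\left(\frac{C_1}{1+C_1}\right)^k[f(\mathbf{x}^0)-f(\mathbf{x}^* )],$$ $$\|\mathbf{x}^k-\mathbf{x}^{k+1}\|_2^2\le\frac2\delta\left(\frac{C_1}{1+C_1}\right)^k[f(\mathbf{x}^0)-f(\mathbf{x}^* )].$$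
   Context: Let $\mathbf{A}\in\mathbb{R}^{n\times n}$ be symmetric positive semidefinite, $\mathbf{b}\in\mathbb{R}^n$, $q(\mathbf{x})=\frac12\mathbf{x}^T\mathbf{A}\mathbf{x}+\mathbf{x}^T\mathbf{b}$, and let $h:\mathbb{R}^n\to\mathbb{R}$ be convex and separable, $h(\mathbf{x})=\sum_{i=1}^n h_i(\mathbf{x}_i)$. Put $f=q+h$, assumed bounded below. $\partial h$ is the convex subdifferential. $\|\cdot\|$ is the Euclidean norm for vectors and the spectral norm for matrices. Let $\mathbf{D}$ be the diagonal part of $\mathbf{A}$ and $\mathbf{L}$ its strictly lower triangular part, so $\mathbf{A}=\mathbf{L}+\mathbf{D}+\mathbf{L}^T$; $\mathrm{diag}(\mathbf{D})$ is the vector of diagonal entries and $\min(\cdot)$ its smallest entry. Given $\omega\in(0,2)$ and $\epsilon\in[0,\infty)$ with all diagonal entries of $\mathbf{B}$ positive, set $\mathbf{B}=\mathbf{L}+\frac1\omega\mathbf{D}+\epsilon\mathbf{I}$ and $\mathbf{C}=\mathbf{L}^T+\frac{\omega-1}{\omega}\mathbf{D}-\epsilon\mathbf{I}$, so $\mathbf{A}=\mathbf{B}+\mathbf{C}$. $\mathcal{T}(\mathbf{x})$ is the unique $\mathbf{z}$ with $\mathbf{0}\in\mathbf{B}\mathbf{z}+\mathbf{C}\mathbf{x}+\mathbf{b}+\partial h(\mathbf{z})$. *)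

theory Defs
  imports "HOL-Analysis.Analysis"
begin

type_synonym 'n vector = "(real, 'n) vec"
type_synonym 'n sqmatrix = "((real, 'n) vec, 'n) vec"

definition symmetric_matrix :: "('n::finite) sqmatrix \<Rightarrow> bool" where
  "symmetric_matrix A \<longleftrightarrow> transpose A = A"

definition pos_semidefinite :: "('n::finite) sqmatrix \<Rightarrow> bool" where
  "pos_semidefinite A \<longleftrightarrow> (\<forall>x. 0 \<le> x \<bullet> (A *v x))"

definition separable :: "(('n::finite) vector \<Rightarrow> real) \<Rightarrow> bool" where
  "separable h \<longleftrightarrow> (\<exists>hc :: 'n \<Rightarrow> real \<Rightarrow> real. \<forall>x. h x = (\<Sum>i\<in>UNIV. hc i (x $ i)))"

definition quadratic :: "('n::finite) sqmatrix \<Rightarrow> 'n vector \<Rightarrow> 'n vector \<Rightarrow> real" where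
  "quadratic A b x = 1/2 * (x \<bullet> (A *v x)) + x \<bullet> b"

definition objective :: "('n::finite) sqmatrix \<Rightarrow> 'n vector \<Rightarrow> ('n vector \<Rightarrow> real) \<Rightarrow> 'n vector \<Rightarrow> real" where
  "objective A b h x = quadratic A b x + h x"

definition subdifferential :: "('a::real_inner \<Rightarrow> real) \<Rightarrow> 'a \<Rightarrow> 'a set" where
  "subdifferential h z = {g. \<forall>y. h z + g \<bullet> (y - z) \<le> h y}"

text \<open>The norm on \<^typ>\<open>real^'n\<close> is Euclidean, so the operator norm it induces
  is the spectral norm.\<close>

definition spectral_norm :: "('n::finite) sqmatrix \<Rightarrow> real" where
  "spectral_norm M = onorm (\<lambda>x. M *v x)"

text \<open>Triangularity refers to the order of the index type: in \<open>A $ i $ j\<close> the row is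
  \<open>i\<close> and the column is \<open>j\<close>.\<close>

definition diag_part :: "('n::finite) sqmatrix \<Rightarrow> 'n sqmatrix" where
  "diag_part A = (\<chi> i j. if i = j then A $ i $ j else 0)"

definition strict_lower_part :: "('n::{finite,linorder}) sqmatrix \<Rightarrow> 'n sqmatrix" where
  "strict_lower_part A = (\<chi> i j. if j < i then A $ i $ j else 0)"

definition diag_vec :: "('n::finite) sqmatrix \<Rightarrow> 'n vector" where
  "diag_vec M = (\<chi> i. M $ i $ i)"

definition min_entry :: "('n::finite) vector \<Rightarrow> real" where
  "min_entry v = Min (range (\<lambda>i. v $ i))"

definition split_B :: "real \<Rightarrow> real \<Rightarrow> ('n::{finite,linorder}) sqmatrix \<Rightarrow> 'n sqmatrix" where
  "split_B \<omega> \<epsilon> A =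
     strict_lower_part A + (1 / \<omega>) *\<^sub>R diag_part A + \<epsilon> *\<^sub>R mat 1"

definition split_C :: "real \<Rightarrow> real \<Rightarrow> ('n::{finite,linorder}) sqmatrix \<Rightarrow> 'n sqmatrix" where
  "split_C \<omega> \<epsilon> A =
     transpose (strict_lower_part A) + ((\<omega> - 1) / \<omega>) *\<^sub>R diag_part A - \<epsilon> *\<^sub>R mat 1"

text \<open>The description below is proper whenever \<open>h\<close> is convex and separable and \<open>split_B \<omega> \<epsilon> A\<close>,
  which is lower triangular, has a positive diagonal: the inclusion then decouples into
  scalar inclusions \<open>0 \<in> \<beta> t + c + \<partial>h\<^sub>i(t)\<close> with \<open>\<beta> > 0\<close>, solved one after the other.\<close>

definition splitting_map ::
  "real \<Rightarrow> real \<Rightarrow> ('n::{finite,linorder}) sqmatrix \<Rightarrow> 'n vector \<Rightarrow> ('n vector \<Rightarrow> real) \<Rightarrow> 'n vector \<Rightarrow> 'n vector"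
where
  "splitting_map \<omega> \<epsilon> A b h x =
     (THE z. 0 \<in> (\<lambda>g. split_B \<omega> \<epsilon> A *v z + split_C \<omega> \<epsilon> A *v x + b + g) ` subdifferential h z)"

end

theory Submission
  imports Defs
begin

text \<open>
  One step \<open>z = \<T>(x)\<close> carries a subgradient \<open>g = -(B z + C x + b)\<close> of \<open>h\<close> at \<open>z\<close>. As \<open>q\<close> is
  quadratic, inserting \<open>g\<close> into the subgradient inequality gives, with \<open>d = z - x\<close> and for
  every \<open>y\<close>,
  \<open>f(z) - f(y) \<le> -\<langle>B d, x - y\<rangle> - \<langle>x - y, A (x - y)\<rangle>/2 - \<langle>d, G d\<rangle>/2\<close>,
  where \<open>G = B - C\<^sup>T\<close> is diagonal and its smallest diagonal entry is \<open>\<delta>\<close>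
  (\<open>splitting_step_inequality\<close>, with \<open>\<langle>d, G d\<rangle>\<close> already estimated by \<open>\<delta> \<parallel>d\<parallel>\<^sup>2\<close>).
  The whole rate comes from this inequality, used for two values of \<open>y\<close>.
  For \<open>y = x\<close> it is sufficient descent, \<open>\<delta>/2 \<parallel>d\<parallel>\<^sup>2 \<le> f(x) - f(z)\<close>. For \<open>y = x\<^sup>*\<close> the
  error bound and Cauchy-Schwarz turn it into
  \<open>f(z) - f(x\<^sup>*) \<le> (\<parallel>B\<parallel> \<eta> - \<delta>/2) \<parallel>d\<parallel>\<^sup>2 = C\<^sub>1 (\<delta>/2) \<parallel>d\<parallel>\<^sup>2\<close>. Eliminating
  \<open>\<parallel>d\<parallel>\<^sup>2\<close> yields \<open>(1 + C\<^sub>1) (f(z) - f(x\<^sup>*)) \<le> C\<^sub>1 (f(x) - f(x\<^sup>*))\<close>. The elimination requires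
  \<open>C\<^sub>1 \<ge> 0\<close>. If some \<open>x\<close> is not a minimizer, then the error bound gives \<open>d \<noteq> 0\<close> there, and
  the second estimate, whose left side is nonnegative, forces \<open>C\<^sub>1 \<ge> 0\<close>;
  otherwise \<open>f\<close> is constant and there is nothing to prove.

  The map \<open>\<T>\<close> is given by a definite description, so a point with the defining inclusion has to
  exist and be unique. The identity \<open>\<langle>d, B d\<rangle> = \<langle>d, A d\<rangle>/2 + \<langle>d, G d\<rangle>/2\<close> makes \<open>B\<close>
  strongly monotone with constant \<open>\<delta>/2\<close>. Uniqueness is then monotonicity of the subdifferential,
  and existence is Banach's fixed point theorem for the forward-backward map
  \<open>z \<mapsto> prox\<^bsub>\<tau>h\<^esub>(z - \<tau>(B z + c))\<close> with a small step \<open>\<tau>\<close>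
  (\<open>strongly_monotone_inclusion_ex1\<close>).
\<close>

section \<open>Subgradients and proximal points\<close>

lemma subdifferential_monotone:
  assumes "g \<in> subdifferential h z" "g' \<in> subdifferential h z'"
  shows "0 \<le> (g - g') \<bullet> (z - z')"
proof -
  have "h z + g \<bullet> (z' - z) \<le> h z'" "h z' + g' \<bullet> (z - z') \<le> h z"
    using assms by (auto simp: subdifferential_def)
  then show ?thesis by (simp add: inner_diff_left inner_diff_right)
qed

lemma subdifferential_scale:
  fixes \<tau> :: real
  assumes "0 < \<tau>"
  shows "\<tau> *\<^sub>R g \<in> subdifferential (\<lambda>x. \<tau> * h x) z \<longleftrightarrow> g \<in> subdifferential h z"
proof -
  have "\<tau> * h z + (\<tau> *\<^sub>R g) \<bullet> (y - z) \<le> \<tau> * h y \<longleftrightarrow> h z + g \<bullet> (y - z) \<le> h y" for y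
  proof -
    have "\<tau> * h z + (\<tau> *\<^sub>R g) \<bullet> (y - z) = \<tau> * (h z + g \<bullet> (y - z))"
      by (simp add: distrib_left)
    then show ?thesis using assms by (simp only: mult_le_cancel_left_pos)
  qed
  then show ?thesis by (simp add: subdifferential_def)
qed

text \<open>The growth needed for coercivity comes from convexity alone: along each ray
  from \<open>u\<close>, the function lies beyond the unit sphere above the line through its values at \<open>u\<close>
  and on the sphere, and the latter values are bounded below by compactness.\<close>

lemma convex_lower_growth:
  fixes h :: "'a::euclidean_space \<Rightarrow> real"
  assumes "convex_on UNIV h"
  obtains c where "0 \<le> c" "\<And>z. 1 \<le> norm (z - u) \<Longrightarrow> h u - c * norm (z - u) \<le> h z"
proof -
  have cont: "continuous_on (cball u 1) h"
    using convex_on_continuous[OF open_UNIV assms] continuous_on_subset by blast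
  obtain w0 where w0: "\<And>w. w \<in> cball u 1 \<Longrightarrow> h w0 \<le> h w"
    using continuous_attains_inf[OF compact_cball _ cont] by fastforce
  show ?thesis
  proof (rule that)
    show "0 \<le> h u - h w0" using w0[of u] by simp
    fix z assume r: "1 \<le> norm (z - u)"
    define r where "r = norm (z - u)"
    define w where "w = (1 - 1/r) *\<^sub>R u + (1/r) *\<^sub>R z"
    have r1: "1 \<le> r" using r r_def by simp
    have "w - u = (1/r) *\<^sub>R (z - u)" by (simp add: w_def algebra_simps)
    then have "norm (w - u) = 1" using r1 by (simp add: r_def[symmetric])
    then have "h w0 \<le> h w" by (intro w0) (simp add: dist_norm norm_minus_commute)
    also have "h w \<le> (1 - 1/r) * h u + (1/r) * h z"
      unfolding w_def using r1 by (intro convex_onD[OF assms]) auto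
    finally have "r * h w0 \<le> r * ((1 - 1/r) * h u + (1/r) * h z)"
      using r1 by (intro mult_left_mono) auto
    also have "\<dots> = (r - 1) * h u + h z" using r1 by (simp add: field_simps)
    finally show "h u - (h u - h w0) * norm (z - u) \<le> h z"
      by (simp add: r_def[symmetric] algebra_simps)
  qed
qed

lemma proximal_minimizer_exists:
  fixes h :: "'a::euclidean_space \<Rightarrow> real"
  assumes "convex_on UNIV h"
  obtains p where "\<And>z. (norm (p - u))\<^sup>2 / 2 + h p \<le> (norm (z - u))\<^sup>2 / 2 + h z"
proof -
  obtain c where c: "0 \<le> c" "\<And>z. 1 \<le> norm (z - u) \<Longrightarrow> h u - c * norm (z - u) \<le> h z"
    using convex_lower_growth[OF assms] by blast
  define F where "F z = (norm (z - u))\<^sup>2 / 2 + h z" for z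
  \<comment> \<open>From radius \<open>2 c\<close> on, the quadratic term outweighs the linear decrease of \<open>h\<close>.\<close>
  define R where "R = max 1 (2 * c)"
  have "continuous_on (cball u R) h"
    using convex_on_continuous[OF open_UNIV assms] continuous_on_subset by blast
  then have "continuous_on (cball u R) F"
    unfolding F_def by (intro continuous_intros) auto
  moreover have "cball u R \<noteq> {}" by (simp add: R_def)
  ultimately obtain p where p: "\<And>z. z \<in> cball u R \<Longrightarrow> F p \<le> F z"
    using continuous_attains_inf[OF compact_cball, of u R F] by blast
  have "F p \<le> F z" for z
  proof (cases "norm (z - u) \<le> R")
    case True
    then show ?thesis by (intro p) (simp add: dist_norm norm_minus_commute)
  next
    case False
    then have n: "1 \<le> norm (z - u)" "2 * c \<le> norm (z - u)" by (auto simp: R_def)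
    have "2 * c * norm (z - u) \<le> norm (z - u) * norm (z - u)"
      using n by (intro mult_right_mono) auto
    then have "F u \<le> F z"
      using c(2)[OF n(1)] by (simp add: F_def power2_eq_square)
    moreover have "F p \<le> F u" by (intro p) (simp add: R_def)
    ultimately show ?thesis by linarith
  qed
  then show ?thesis using that by (auto simp: F_def)
qed

lemma nonneg_if_dominates_small_multiples:
  fixes a b :: real
  assumes "0 \<le> b" "\<And>t. 0 < t \<Longrightarrow> t \<le> 1 \<Longrightarrow> - (t * b) \<le> a"
  shows "0 \<le> a"
proof (rule ccontr)
  assume "\<not> 0 \<le> a"
  define t where "t = min 1 (- a / (b + 1))"
  have t: "0 < t" "t \<le> 1" using \<open>\<not> 0 \<le> a\<close> assms(1) by (auto simp: t_def divide_neg_pos)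
  have "t * (b + 1) \<le> (- a / (b + 1)) * (b + 1)"
    using assms(1) by (intro mult_right_mono) (auto simp: t_def)
  also have "\<dots> = - a" using assms(1) by simp
  finally show False using assms(2)[OF t] t by (simp add: algebra_simps)
qed

text \<open>A proximal point of \<open>h\<close> at \<open>u\<close>, characterised by its optimality condition. The condition
  is read off from the minimizing property along the segment to \<open>y\<close>: to first order in the
  segment parameter, only the derivative of the quadratic term and the chord slope of \<open>h\<close>
  remain.\<close>

lemma proximal_point_exists:
  fixes h :: "'a::euclidean_space \<Rightarrow> real"
  assumes "convex_on UNIV h"
  shows "\<exists>p. u - p \<in> subdifferential h p"
proof -
  obtain p where p: "\<And>z. (norm (p - u))\<^sup>2 / 2 + h p \<le> (norm (z - u))\<^sup>2 / 2 + h z"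
    using proximal_minimizer_exists[OF assms] by blast
  have "h p + (u - p) \<bullet> (y - p) \<le> h y" for y
  proof -
    have "- (t * ((norm (y - p))\<^sup>2 / 2)) \<le> h y - h p - (u - p) \<bullet> (y - p)"
      if t: "0 < t" "t \<le> 1" for t
    proof -
      define w where "w = (1 - t) *\<^sub>R p + t *\<^sub>R y"
      have hw: "h w \<le> (1 - t) * h p + t * h y"
        unfolding w_def using t by (intro convex_onD[OF assms]) auto
      have wu: "w - u = (p - u) + t *\<^sub>R (y - p)" by (simp add: w_def algebra_simps)
      have nw: "(norm (w - u))\<^sup>2
          = (norm (p - u))\<^sup>2 - 2 * t * ((u - p) \<bullet> (y - p)) + t\<^sup>2 * (norm (y - p))\<^sup>2"
        unfolding wu power2_norm_eq_inner
        by (simp add: inner_add_left inner_add_right inner_diff_left inner_diff_right inner_commute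
              algebra_simps power2_eq_square)
      have "t * (h y - h p - s + t * (v / 2)) = t * h y - t * h p - t * s + t\<^sup>2 * v / 2"
        for s v by (simp add: algebra_simps power2_eq_square)
      moreover have "(1 - t) * h p = h p - t * h p" by (simp add: algebra_simps)
      ultimately have "0 \<le> t * (h y - h p - (u - p) \<bullet> (y - p) + t * ((norm (y - p))\<^sup>2 / 2))"
        using p[of w] hw unfolding nw by (simp add: add_divide_distrib diff_divide_distrib)
      then show ?thesis using t by (simp add: zero_le_mult_iff)
    qed
    then have "0 \<le> h y - h p - (u - p) \<bullet> (y - p)"
      by (rule nonneg_if_dominates_small_multiples[rotated]) simp_all
    then show ?thesis by simp
  qed
  then show ?thesis by (auto simp: subdifferential_def)
qed

lemma proximal_point_nonexpansive:
  assumes "u - p \<in> subdifferential h p" "u' - p' \<in> subdifferential h p'"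
  shows "norm (p - p') \<le> norm (u - u')"
proof -
  have "0 \<le> ((u - p) - (u' - p')) \<bullet> (p - p')"
    using subdifferential_monotone[OF assms] .
  then have "(norm (p - p'))\<^sup>2 \<le> (u - u') \<bullet> (p - p')"
    by (simp add: power2_norm_eq_inner algebra_simps inner_commute)
  also have "\<dots> \<le> norm (u - u') * norm (p - p')" by (rule norm_cauchy_schwarz)
  finally show ?thesis
    by (cases "p = p'") (simp_all add: power2_eq_square)
qed

section \<open>Inclusions with a strongly monotone linear part\<close>

text \<open>A gradient-type step along a strongly monotone linear map is a contraction once the step
  size is small. With \<open>M \<ge> \<parallel>B\<parallel>\<close>, the squared factor \<open>1 - 2 \<tau> \<mu> + \<tau>\<^sup>2 M\<^sup>2\<close> is smallest at
  \<open>\<tau> = \<mu>/M\<^sup>2\<close>; taking \<open>M = \<parallel>B\<parallel> + \<mu>\<close> only keeps \<open>M\<close> positive and the factor nonnegative.\<close>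

lemma strongly_monotone_step_contracts:
  fixes B :: "'a::real_inner \<Rightarrow> 'a"
  assumes B: "bounded_linear B" and "0 < \<mu>"
    and mono: "\<And>d. \<mu> * (norm d)\<^sup>2 \<le> d \<bullet> B d"
  obtains \<tau> \<rho> where "0 < \<tau>" "0 \<le> \<rho>" "\<rho> < 1" "\<And>d. norm (d - \<tau> *\<^sub>R B d) \<le> \<rho> * norm d"
proof -
  define M where "M = onorm B + \<mu>"
  have M: "0 < M" "\<mu> \<le> M" "onorm B \<le> M"
    using onorm_pos_le[OF B] \<open>0 < \<mu>\<close> by (auto simp: M_def)
  define \<tau> where "\<tau> = \<mu> / M\<^sup>2"
  define \<rho> where "\<rho> = sqrt (1 - \<mu>\<^sup>2 / M\<^sup>2)"
  have "\<mu>\<^sup>2 \<le> M\<^sup>2" using M \<open>0 < \<mu>\<close> by (intro power_mono) auto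
  then have q: "0 \<le> 1 - \<mu>\<^sup>2 / M\<^sup>2" "0 < \<mu>\<^sup>2 / M\<^sup>2" using M \<open>0 < \<mu>\<close> by auto
  show ?thesis
  proof (rule that[of \<tau> \<rho>])
    show "0 < \<tau>" using M \<open>0 < \<mu>\<close> by (simp add: \<tau>_def)
    show "0 \<le> \<rho>" "\<rho> < 1" using q by (auto simp: \<rho>_def)
    fix d
    have "norm (B d) \<le> M * norm d"
      using onorm[OF B, of d] mult_right_mono[OF M(3), of "norm d"] by simp
    then have Bd: "(norm (B d))\<^sup>2 \<le> M\<^sup>2 * (norm d)\<^sup>2"
      by (metis norm_ge_zero power_mono power_mult_distrib)
    have "(norm (d - \<tau> *\<^sub>R B d))\<^sup>2 = (norm d)\<^sup>2 - 2 * \<tau> * (d \<bullet> B d) + \<tau>\<^sup>2 * (norm (B d))\<^sup>2"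
      unfolding power2_norm_eq_inner
      by (simp add: algebra_simps inner_commute power2_eq_square)
    also have "\<dots> \<le> (norm d)\<^sup>2 - 2 * \<tau> * (\<mu> * (norm d)\<^sup>2) + \<tau>\<^sup>2 * (M\<^sup>2 * (norm d)\<^sup>2)"
      using \<open>0 < \<tau>\<close> by (intro add_mono diff_mono mult_left_mono mono Bd) auto
    also have "\<dots> = (1 - \<mu>\<^sup>2 / M\<^sup>2) * (norm d)\<^sup>2"
      using M by (simp add: \<tau>_def field_simps power2_eq_square)
    also have "\<dots> = (\<rho> * norm d)\<^sup>2" using q by (simp add: \<rho>_def power_mult_distrib)
    finally show "norm (d - \<tau> *\<^sub>R B d) \<le> \<rho> * norm d"
      using \<open>0 \<le> \<rho>\<close> by (auto intro: power2_le_imp_le)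
  qed
qed

text \<open>A solution is the same as a fixed point of the forward-backward map, the proximal point of
  \<open>\<tau> h\<close> after a forward step along \<open>B\<close>. The backward part is nonexpansive and the forward part
  contracts.\<close>

lemma strongly_monotone_inclusion_ex1:
  fixes B :: "'a::euclidean_space \<Rightarrow> 'a" and h :: "'a \<Rightarrow> real"
  assumes B: "bounded_linear B" and "0 < \<mu>"
    and mono: "\<And>d. \<mu> * (norm d)\<^sup>2 \<le> d \<bullet> B d"
    and h: "convex_on UNIV h"
  shows "\<exists>!z. - (B z + c) \<in> subdifferential h z"
proof -
  interpret B: bounded_linear B by fact
  obtain \<tau> \<rho> where \<tau>: "0 < \<tau>" and \<rho>: "0 \<le> \<rho>" "\<rho> < 1"
    and contr: "\<And>d. norm (d - \<tau> *\<^sub>R B d) \<le> \<rho> * norm d"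
    using strongly_monotone_step_contracts[OF B \<open>0 < \<mu>\<close> mono] by metis
  have "convex_on UNIV (\<lambda>x. \<tau> * h x)" using \<tau> h by (intro convex_on_cmul) auto
  then have "\<forall>u. \<exists>p. u - p \<in> subdifferential (\<lambda>x. \<tau> * h x) p"
    using proximal_point_exists by blast
  then obtain P where P: "\<And>u. u - P u \<in> subdifferential (\<lambda>x. \<tau> * h x) (P u)"
    by metis
  define T where "T z = P (z - \<tau> *\<^sub>R (B z + c))" for z
  have "dist (T z) (T z') \<le> \<rho> * dist z z'" for z z'
  proof -
    have "dist (T z) (T z') \<le> norm ((z - \<tau> *\<^sub>R (B z + c)) - (z' - \<tau> *\<^sub>R (B z' + c)))"
      unfolding T_def dist_norm by (rule proximal_point_nonexpansive[OF P P])
    also have "\<dots> = norm ((z - z') - \<tau> *\<^sub>R B (z - z'))" by (simp add: B.diff algebra_simps)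
    also have "\<dots> \<le> \<rho> * dist z z'" unfolding dist_norm by (rule contr)
    finally show ?thesis .
  qed
  then obtain z where "T z = z"
    using banach_fix_type[OF \<rho>, of T] by blast
  then have "\<tau> *\<^sub>R (- (B z + c)) \<in> subdifferential (\<lambda>x. \<tau> * h x) z"
    using P[of "z - \<tau> *\<^sub>R (B z + c)"] by (simp add: T_def del: minus_add_distrib)
  then have "- (B z + c) \<in> subdifferential h z" using subdifferential_scale[OF \<tau>] by blast
  moreover have "z = z'" if "- (B z + c) \<in> subdifferential h z"
    "- (B z' + c) \<in> subdifferential h z'" for z z'
  proof -
    have "0 \<le> (- (B z + c) - - (B z' + c)) \<bullet> (z - z')"
      by (rule subdifferential_monotone[OF that])
    also have "- (B z + c) - - (B z' + c) = - B (z - z')" by (simp add: B.diff)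
    finally have "\<mu> * (norm (z - z'))\<^sup>2 \<le> 0"
      using mono[of "z - z'"] by (simp add: inner_commute)
    then show ?thesis using \<open>0 < \<mu>\<close> by (simp add: mult_le_0_iff)
  qed
  ultimately show ?thesis by blast
qed

section \<open>The matrix splitting\<close>

lemma splitting_sum:
  assumes "symmetric_matrix A" "\<omega> \<noteq> 0"
  shows "split_B \<omega> \<epsilon> A *v x + split_C \<omega> \<epsilon> A *v x = A *v x"
proof -
  have sym: "A $ i $ j = A $ j $ i" for i j
    using assms(1) unfolding symmetric_matrix_def transpose_def
    by (metis (no_types) vec_lambda_beta)
  have "(split_B \<omega> \<epsilon> A + split_C \<omega> \<epsilon> A) $ i $ j = A $ i $ j" for i j
  proof -
    have "(split_B \<omega> \<epsilon> A + split_C \<omega> \<epsilon> A) $ i $ j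
        = (if j < i then A $ i $ j else 0) + (if i < j then A $ j $ i else 0)
          + (if i = j then (1 / \<omega> + (\<omega> - 1) / \<omega>) * A $ i $ j else 0)"
      by (simp add: split_B_def split_C_def strict_lower_part_def diag_part_def transpose_def
            mat_def distrib_right)
    also have "\<dots> = A $ i $ j"
      using assms(2) sym by (cases i j rule: linorder_cases) (auto simp: field_simps)
    finally show ?thesis .
  qed
  then have "split_B \<omega> \<epsilon> A + split_C \<omega> \<epsilon> A = A" by (simp add: vec_eq_iff)
  then show ?thesis by (metis matrix_vector_mult_add_rdistrib)
qed

text \<open>The triangular parts of \<open>B\<close> and of the transpose of \<open>C\<close> coincide, so that the two
  quadratic forms differ by a diagonal one only.\<close>

lemma splitting_quadratic_form_gap:
  fixes A :: "('n::{finite,linorder}) sqmatrix"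
  assumes "0 < \<omega>" "\<omega> < 2"
  shows "d \<bullet> (split_C \<omega> \<epsilon> A *v d)
      + (2 * \<epsilon> + (2 - \<omega>) / \<omega> * min_entry (diag_vec (diag_part A))) * (norm d)\<^sup>2
    \<le> d \<bullet> (split_B \<omega> \<epsilon> A *v d)"
proof -
  let ?m = "min_entry (diag_vec (diag_part A))"
  define g where "g i = 2 * \<epsilon> + (2 - \<omega>) / \<omega> * A $ i $ i" for i
  have entries: "split_B \<omega> \<epsilon> A $ i $ j
      = transpose (split_C \<omega> \<epsilon> A) $ i $ j + (if i = j then g i else 0)" for i j
    using assms
    by (auto simp: split_B_def split_C_def strict_lower_part_def diag_part_def transpose_def
          mat_def g_def field_simps)
  have "d \<bullet> (split_B \<omega> \<epsilon> A *v d) - d \<bullet> (transpose (split_C \<omega> \<epsilon> A) *v d)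
      = (\<Sum>i\<in>UNIV. g i * (d $ i)\<^sup>2)"
  proof -
    have "(split_B \<omega> \<epsilon> A *v d) $ i
        = (transpose (split_C \<omega> \<epsilon> A) *v d) $ i + g i * d $ i" for i
      by (simp add: matrix_vector_mult_def entries distrib_right sum.distrib
            if_distrib[where f = "\<lambda>x. x * _"] cong: if_cong)
    then show ?thesis
      by (simp add: inner_vec_def distrib_left sum.distrib power2_eq_square mult_ac)
  qed
  moreover have "d \<bullet> (transpose (split_C \<omega> \<epsilon> A) *v d) = d \<bullet> (split_C \<omega> \<epsilon> A *v d)"
    by (metis dot_lmul_matrix inner_commute transpose_matrix_vector)
  moreover have "(2 * \<epsilon> + (2 - \<omega>) / \<omega> * ?m) * (norm d)\<^sup>2 \<le> (\<Sum>i\<in>UNIV. g i * (d $ i)\<^sup>2)"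
  proof -
    have "?m \<le> A $ i $ i" for i
    proof -
      have "?m \<le> diag_vec (diag_part A) $ i" unfolding min_entry_def by (intro Min_le) auto
      then show ?thesis by (simp add: diag_vec_def diag_part_def)
    qed
    then have "2 * \<epsilon> + (2 - \<omega>) / \<omega> * ?m \<le> g i" for i
      unfolding g_def using assms by (intro add_left_mono mult_left_mono) auto
    moreover have "(norm d)\<^sup>2 = (\<Sum>i\<in>UNIV. (d $ i)\<^sup>2)"
      unfolding power2_norm_eq_inner by (simp add: inner_vec_def power2_eq_square)
    ultimately show ?thesis
      by (auto simp: sum_distrib_left intro!: sum_mono mult_right_mono)
  qed
  ultimately show ?thesis by linarith
qed

lemma splitting_map_subgradient:
  fixes A :: "('n::{finite,linorder}) sqmatrix"
  assumes "symmetric_matrix A" "pos_semidefinite A" "convex_on UNIV h" "0 < \<omega>" "\<omega> < 2"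
    and \<delta>: "\<delta> = 2 * \<epsilon> + (2 - \<omega>) / \<omega> * min_entry (diag_vec (diag_part A))" "0 < \<delta>"
    and z: "z = splitting_map \<omega> \<epsilon> A b h x"
  shows "- (split_B \<omega> \<epsilon> A *v z + split_C \<omega> \<epsilon> A *v x + b) \<in> subdifferential h z"
proof -
  let ?B = "split_B \<omega> \<epsilon> A" and ?C = "split_C \<omega> \<epsilon> A"
  have mono: "\<delta> / 2 * (norm d)\<^sup>2 \<le> d \<bullet> (?B *v d)" for d
  proof -
    have "d \<bullet> (?B *v d) + d \<bullet> (?C *v d) = d \<bullet> (A *v d)"
      using splitting_sum[of A \<omega> \<epsilon> d] assms(1,4) by (simp add: inner_add_right[symmetric])
    moreover have "0 \<le> d \<bullet> (A *v d)" using assms(2) by (simp add: pos_semidefinite_def)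
    moreover have "d \<bullet> (?C *v d) + \<delta> * (norm d)\<^sup>2 \<le> d \<bullet> (?B *v d)"
      using splitting_quadratic_form_gap[OF assms(4,5)] by (simp add: \<delta>(1))
    ultimately show ?thesis by (simp add: field_simps)
  qed
  have ex1: "\<exists>!z. - (?B *v z + (?C *v x + b)) \<in> subdifferential h z"
  proof (rule strongly_monotone_inclusion_ex1[OF _ _ mono assms(3)])
    show "bounded_linear ((*v) ?B)" by (rule matrix_vector_mul_bounded_linear)
    show "0 < \<delta> / 2" using \<open>0 < \<delta>\<close> by simp
  qed
  have incl: "0 \<in> (\<lambda>g. ?B *v z + ?C *v x + b + g) ` subdifferential h z
      \<longleftrightarrow> - (?B *v z + (?C *v x + b)) \<in> subdifferential h z" for z
  proof -
    have "0 = v + g \<longleftrightarrow> g = - v" for v g :: "'n vector" by (metis add_eq_0_iff)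
    then have "0 \<in> (\<lambda>g. v + g) ` S \<longleftrightarrow> - v \<in> S" for v :: "'n vector" and S
      by (simp add: image_iff)
    then show ?thesis unfolding add.assoc[symmetric] .
  qed
  have "z = (THE z. - (?B *v z + (?C *v x + b)) \<in> subdifferential h z)"
    unfolding z splitting_map_def incl ..
  then show ?thesis using theI'[OF ex1] by (simp only: add.assoc)
qed

section \<open>Decrease of the objective along the iteration\<close>

text \<open>The master inequality. The exact second-order expansion of the quadratic around \<open>z\<close> meets
  the subgradient inequality for \<open>h\<close> at \<open>z\<close>; all terms are then rearranged around \<open>x\<close>, where
  the error bound lives.\<close>

lemma splitting_step_inequality:
  fixes A :: "('n::{finite,linorder}) sqmatrix"
  assumes sym: "symmetric_matrix A" and \<omega>: "0 < \<omega>" "\<omega> < 2"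
    and \<delta>: "\<delta> = 2 * \<epsilon> + (2 - \<omega>) / \<omega> * min_entry (diag_vec (diag_part A))"
    and g: "- (split_B \<omega> \<epsilon> A *v z + split_C \<omega> \<epsilon> A *v x + b) \<in> subdifferential h z"
  shows "objective A b h z - objective A b h y
    \<le> - ((split_B \<omega> \<epsilon> A *v (z - x)) \<bullet> (x - y)) - (x - y) \<bullet> (A *v (x - y)) / 2
       - \<delta> / 2 * (norm (z - x))\<^sup>2"
proof -
  let ?B = "split_B \<omega> \<epsilon> A" and ?C = "split_C \<omega> \<epsilon> A"
  define d e where "d = z - x" and "e = x - y"
  have ze: "z - y = d + e" by (simp add: d_def e_def)
  have self: "u \<bullet> (A *v v) = v \<bullet> (A *v u)" for u v
    using sym unfolding symmetric_matrix_def
    by (metis dot_lmul_matrix inner_commute transpose_matrix_vector)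
  have BC: "?B *v u = A *v u - ?C *v u" for u
    using splitting_sum[of A \<omega> \<epsilon> u] sym \<omega> by (simp add: algebra_simps)
  have Y: "y = z - (d + e)" using ze by (simp add: algebra_simps)
  have yz: "y - z = - (d + e)" using ze by (simp add: algebra_simps)
  have quad: "quadratic A b z - quadratic A b y
      = (A *v z + b) \<bullet> (d + e) - (d + e) \<bullet> (A *v (d + e)) / 2"
    unfolding Y quadratic_def
    by (simp add: matrix_vector_mult_diff_distrib inner_diff_left inner_diff_right inner_add_left
          self[of z "d + e"] inner_commute[of b] inner_commute[of "A *v z"] field_simps)
  have "h z + (- (?B *v z + ?C *v x + b)) \<bullet> (y - z) \<le> h y"
    using g by (auto simp: subdifferential_def)
  then have "h z - h y \<le> - ((?B *v z + ?C *v x + b) \<bullet> (d + e))"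
    unfolding yz inner_minus_left inner_minus_right by linarith
  moreover have "(A *v z + b) - (?B *v z + ?C *v x + b) = ?C *v d"
    by (simp add: BC d_def matrix_vector_mult_diff_distrib)
  ultimately have "objective A b h z - objective A b h y
      \<le> (?C *v d) \<bullet> (d + e) - (d + e) \<bullet> (A *v (d + e)) / 2"
    using quad inner_diff_left[of "A *v z + b" "?B *v z + ?C *v x + b" "d + e"]
    unfolding objective_def by simp
  also have "\<dots> = - ((?B *v d) \<bullet> e) - e \<bullet> (A *v e) / 2
      + (d \<bullet> (?C *v d) - d \<bullet> (?B *v d)) / 2"
    unfolding BC
    by (simp add: matrix_vector_right_distrib inner_diff_left inner_diff_right inner_add_left
          inner_add_right self[of e d] inner_commute[of "A *v _"] inner_commute[of "?C *v _"]
          field_simps)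
  also have "\<dots> \<le> - ((?B *v d) \<bullet> e) - e \<bullet> (A *v e) / 2 - \<delta> / 2 * (norm d)\<^sup>2"
    using splitting_quadratic_form_gap[OF \<omega>, of d \<epsilon> A] \<delta> by simp
  finally show ?thesis by (simp add: d_def e_def)
qed

text \<open>The instance \<open>y = x\<close> of the step inequality, where only the diagonal gap between \<open>B\<close> and
  the transpose of \<open>C\<close> survives.\<close>

lemma sufficient_descent:
  fixes A :: "('n::{finite,linorder}) sqmatrix"
  assumes "symmetric_matrix A" "pos_semidefinite A" "convex_on UNIV h" "0 < \<omega>" "\<omega> < 2"
    and "\<delta> = 2 * \<epsilon> + (2 - \<omega>) / \<omega> * min_entry (diag_vec (diag_part A))" "0 < \<delta>"
    and "z = splitting_map \<omega> \<epsilon> A b h x"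
  shows "\<delta> / 2 * (norm (x - z))\<^sup>2 \<le> objective A b h x - objective A b h z"
  using splitting_step_inequality[OF assms(1,4,5,6) splitting_map_subgradient[OF assms], of x]
  by (simp add: norm_minus_commute)

text \<open>Once \<open>\<parallel>x - y\<parallel>\<close> is controlled by the step length, every term of the step inequality is of
  second order in the step. The factor is written against \<open>\<delta>/2 \<parallel>x - z\<parallel>\<^sup>2\<close> because this is
  the quantity that sufficient descent bounds.\<close>

lemma objective_gap_bound:
  fixes A :: "('n::{finite,linorder}) sqmatrix"
  assumes "symmetric_matrix A" and psd: "pos_semidefinite A"
    and "convex_on UNIV h" "0 < \<omega>" "\<omega> < 2"
    and "\<delta> = 2 * \<epsilon> + (2 - \<omega>) / \<omega> * min_entry (diag_vec (diag_part A))" "0 < \<delta>"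
    and "z = splitting_map \<omega> \<epsilon> A b h x"
    and eb: "norm (x - y) \<le> \<eta> * norm (x - z)"
  shows "objective A b h z - objective A b h y
    \<le> (2 * spectral_norm (split_B \<omega> \<epsilon> A) * \<eta> / \<delta> - 1) * (\<delta> / 2 * (norm (x - z))\<^sup>2)"
proof -
  let ?B = "split_B \<omega> \<epsilon> A"
  have nB: "norm (?B *v (z - x)) \<le> spectral_norm ?B * norm (x - z)"
    unfolding spectral_norm_def
    using onorm[OF matrix_vector_mul_bounded_linear, of ?B "z - x"]
    by (simp add: norm_minus_commute)
  have "- ((?B *v (z - x)) \<bullet> (x - y)) \<le> norm (?B *v (z - x)) * norm (x - y)"
    using norm_cauchy_schwarz[of "- (?B *v (z - x))" "x - y"] by simp
  also have "\<dots> \<le> (spectral_norm ?B * norm (x - z)) * (\<eta> * norm (x - z))"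
    by (rule mult_mono'[OF nB eb]) auto
  finally have "- ((?B *v (z - x)) \<bullet> (x - y)) \<le> spectral_norm ?B * \<eta> * (norm (x - z))\<^sup>2"
    by (simp add: power2_eq_square mult_ac)
  moreover have "0 \<le> (x - y) \<bullet> (A *v (x - y))" using psd by (simp add: pos_semidefinite_def)
  moreover note splitting_step_inequality[OF assms(1,4,5,6)
      splitting_map_subgradient[OF assms(1-8)], of y]
  ultimately have "objective A b h z - objective A b h y
      \<le> spectral_norm ?B * \<eta> * (norm (x - z))\<^sup>2 - \<delta> / 2 * (norm (x - z))\<^sup>2"
    by (simp add: norm_minus_commute)
  also have "\<dots> = (2 * spectral_norm ?B * \<eta> / \<delta> - 1) * (\<delta> / 2 * (norm (x - z))\<^sup>2)"
    using \<open>0 < \<delta>\<close> by (simp add: field_simps)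
  finally show ?thesis .
qed

theorem theorem2:
  fixes A :: "('n::{finite,linorder}) sqmatrix"
    and b :: "'n vector"
    and h :: "'n vector \<Rightarrow> real"
    and \<omega> \<epsilon> \<delta> \<eta> C1 :: real
    and xstar :: "'n vector"
    and X :: "nat \<Rightarrow> 'n vector"
  assumes "symmetric_matrix A"
    and "pos_semidefinite A"
    and "convex_on UNIV h"
    and "separable h"
    and "bdd_below (range (objective A b h))"
    and "0 < \<omega>" and "\<omega> < 2"
    and "0 \<le> \<epsilon>"
    and "\<forall>i. 0 < split_B \<omega> \<epsilon> A $ i $ i"
    and "\<delta> = 2 * \<epsilon> + (2 - \<omega>) / \<omega> * min_entry (diag_vec (diag_part A))"
    and "0 < \<delta>"
    and "is_arg_min (objective A b h) (\<lambda>_. True) xstar"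
    and "0 < \<eta>"
    and "\<forall>x. \<not> is_arg_min (objective A b h) (\<lambda>_. True) x \<longrightarrow>
           norm (x - xstar) \<le> \<eta> * norm (x - splitting_map \<omega> \<epsilon> A b h x)"
    and "\<forall>k. X (Suc k) = splitting_map \<omega> \<epsilon> A b h (X k)"
    and "bounded (range X)"
    and "C1 = 2 * spectral_norm (split_B \<omega> \<epsilon> A) * \<eta> / \<delta> - 1"
  shows "\<forall>k. objective A b h (X k) - objective A b h xstar
               \<le> (C1 / (1 + C1)) ^ k * (objective A b h (X 0) - objective A b h xstar)
           \<and> (norm (X k - X (Suc k)))\<^sup>2
               \<le> 2 / \<delta> * (C1 / (1 + C1)) ^ k * (objective A b h (X 0) - objective A b h xstar)"
proof -
  let ?f = "objective A b h"
  define E where "E x = ?f x - ?f xstar" for x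
  define r where "r = C1 / (1 + C1)"
  have min: "is_arg_min ?f (\<lambda>_. True) x \<longleftrightarrow> E x = 0" and E0: "0 \<le> E x" for x
    using assms(12) unfolding is_arg_min_linorder E_def by (auto intro: antisym)
  have desc: "\<delta> / 2 * (norm (x - splitting_map \<omega> \<epsilon> A b h x))\<^sup>2
      \<le> E x - E (splitting_map \<omega> \<epsilon> A b h x)" for x
    using sufficient_descent[OF assms(1-3,6,7,10,11) refl, where b = b and x = x] by (simp add: E_def)
  have gap: "E (splitting_map \<omega> \<epsilon> A b h x)
      \<le> C1 * (\<delta> / 2 * (norm (x - splitting_map \<omega> \<epsilon> A b h x))\<^sup>2)" if "E x \<noteq> 0" for x
    using objective_gap_bound[OF assms(1-3,6,7,10,11) refl, where b = b and x = x and y = xstar and \<eta> = \<eta>] assms(14) that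
    unfolding assms(17) E_def[symmetric] min by blast
  \<comment> \<open>At a nonminimizer the step is nonzero by the error bound, so a negative \<open>C1\<close> would
    push the objective below its minimum.\<close>
  have C1: "0 \<le> C1" if "E x \<noteq> 0" for x
  proof (rule ccontr)
    assume neg: "\<not> 0 \<le> C1"
    have "x \<noteq> xstar" using that by (auto simp: E_def)
    moreover have "norm (x - xstar) \<le> \<eta> * norm (x - splitting_map \<omega> \<epsilon> A b h x)"
      using that assms(14) unfolding min by blast
    ultimately have "x \<noteq> splitting_map \<omega> \<epsilon> A b h x" by auto
    then have "0 < \<delta> / 2 * (norm (x - splitting_map \<omega> \<epsilon> A b h x))\<^sup>2" using assms(11) by simp
    then have "C1 * (\<delta> / 2 * (norm (x - splitting_map \<omega> \<epsilon> A b h x))\<^sup>2) < 0"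
      using neg by (intro mult_neg_pos) auto
    then show False using gap[OF that] E0[of "splitting_map \<omega> \<epsilon> A b h x"] by linarith
  qed
  have rate: "E (splitting_map \<omega> \<epsilon> A b h x) \<le> r * E x" for x
  proof (cases "E x = 0")
    case True
    have "0 \<le> \<delta> / 2 * (norm (x - splitting_map \<omega> \<epsilon> A b h x))\<^sup>2" using assms(11) by simp
    then show ?thesis using desc[of x] True by simp
  next
    case False
    let ?z = "splitting_map \<omega> \<epsilon> A b h x"
    have "E ?z \<le> C1 * (E x - E ?z)"
      using gap[OF False] mult_left_mono[OF desc[of x] C1[OF False]] by linarith
    then show ?thesis using C1[OF False] by (simp add: r_def field_simps)
  qed
  \<comment> \<open>If every point is a minimizer, \<open>r\<close> can be negative, but then both sides vanish.\<close>
  have powers: "E (X k) \<le> r ^ k * E (X 0)" for k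
  proof (cases "\<exists>x. E x \<noteq> 0")
    case True
    then have "0 \<le> r" using C1 by (auto simp: r_def)
    show ?thesis
    proof (induction k)
      case (Suc k)
      have "E (X (Suc k)) \<le> r * E (X k)" using rate assms(15) by simp
      also have "\<dots> \<le> r * (r ^ k * E (X 0))" using Suc \<open>0 \<le> r\<close> by (rule mult_left_mono)
      finally show ?case by simp
    qed simp
  qed simp
  show ?thesis
  proof (intro allI conjI)
    fix k
    show "?f (X k) - ?f xstar \<le> (C1 / (1 + C1)) ^ k * (?f (X 0) - ?f xstar)"
      using powers[of k] by (simp add: E_def r_def)
    have "\<delta> / 2 * (norm (X k - X (Suc k)))\<^sup>2 \<le> r ^ k * E (X 0)"
      using desc[of "X k"] E0[of "X (Suc k)"] powers[of k] assms(15) by simp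
    then have "(norm (X k - X (Suc k)))\<^sup>2 \<le> 2 / \<delta> * r ^ k * E (X 0)"
      using assms(11) by (simp add: field_simps)
    then show "(norm (X k - X (Suc k)))\<^sup>2
        \<le> 2 / \<delta> * (C1 / (1 + C1)) ^ k * (?f (X 0) - ?f xstar)"
      unfolding E_def r_def .
  qed
qed

end
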